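(* Assume the Prime $k$-tuple Conjecture (for every $k\ge 1$). Let $a,q$ be fixed coprime natural numbers. Then there exist arbitrarily long arithmetic progressions of Carmichael numbers, each of which lies in the residue class $a \bmod q$ and is a product of three distinct prime numbers. That is, for every $L\in\mathbb{N}$ there exist natural numbers $N_1<N_2<\cdots<N_L$ forming an arithmetic progression such that, for each $j=1,\ldots,L$, the number $N_j$ is a Carmichael number, $N_j\equiv a \bmod q$, and $N_j$ is a product of three distinct primes.
   Context: Natural numbers are positive integers. A Carmichael number is a composite natural number $n$ such that $x^n\equiv x \bmod n$ for all $x\in\mathbb{Z}$. Arithmetic progressions are understood to be nonconstant. A $k$-tuple of linear forms $\mathcal{H}(X)=\{g_jX+h_j\}_{j=1}^k$ in $\mathbb{Z}[X]$ is called admissible if the associated polynomial $f_{\mathcal{H}}(X)=\prod_{j=1}^k(g_jX+h_j)$ has no fixed prime divisor, that is, if for every prime $p$ the number of residue classes $n \bmod p$ with $f_{\mathcal{H}}(n)\equiv 0\bmod p$ is not equal to $p$. The Prime $k$-tuple Conjecture is the following assertion: if $\mathcal{H}(X)=\{g_jX+h_j\}_{j=1}^k$ is an admissible $k$-tuple of linear forms in $\mathbb{Z}[X]$ satisfying $g_1,\ldots,g_k>0$ and $\prod_{1\le i<j\le k}(g_ih_j-g_jh_i)\ne 0$, then for infinitely many $n\in\mathbb{N}$ all of the numbers $g_1n+h_1,\ldots,g_kn+h_k$ are prime. *)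

theory Defs
  imports "HOL-Number_Theory.Number_Theory" "HOL-Computational_Algebra.Polynomial"
begin

definition carmichael :: "nat \<Rightarrow> bool" where
  "carmichael n \<longleftrightarrow> n > 1 \<and> \<not> prime n \<and> (\<forall>x::int. [x ^ n = x] (mod int n))"

definition product_of_three_distinct_primes :: "nat \<Rightarrow> bool" where
  "product_of_three_distinct_primes n \<longleftrightarrow>
     (\<exists>p1 p2 p3. prime p1 \<and> prime p2 \<and> prime p3 \<and>
        p1 \<noteq> p2 \<and> p1 \<noteq> p3 \<and> p2 \<noteq> p3 \<and> n = p1 * p2 * p3)"

text \<open>A tuple of \<open>k\<close> linear forms is given by its coefficient functions \<open>g\<close> and \<open>h\<close>,
  of which only the values on \<open>{1..k}\<close> matter.\<close>

definition tuple_poly :: "nat \<Rightarrow> (nat \<Rightarrow> int) \<Rightarrow> (nat \<Rightarrow> int) \<Rightarrow> int poly" where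
  "tuple_poly k g h = (\<Prod>j=1..k. [:h j, g j:])"

definition admissible :: "nat \<Rightarrow> (nat \<Rightarrow> int) \<Rightarrow> (nat \<Rightarrow> int) \<Rightarrow> bool" where
  "admissible k g h \<longleftrightarrow>
     (\<forall>p::nat. prime p \<longrightarrow>
        card {n \<in> {0..<int p}. [poly (tuple_poly k g h) n = 0] (mod int p)} \<noteq> p)"

text \<open>Primality on \<open>int\<close> entails positivity.\<close>

definition prime_tuple_conjecture :: "nat \<Rightarrow> bool" where
  "prime_tuple_conjecture k \<longleftrightarrow>
     (\<forall>g h :: nat \<Rightarrow> int.
        admissible k g h \<longrightarrow>
        (\<forall>j\<in>{1..k}. g j > 0) \<longrightarrow>
        (\<Prod>j=1..k. \<Prod>i=1..<j. (g i * h j - g j * h i)) \<noteq> 0 \<longrightarrow>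
        infinite {n::nat. n > 0 \<and> (\<forall>j\<in>{1..k}. prime (g j * int n + h j))})"

definition increasing_arith_prog :: "nat \<Rightarrow> (nat \<Rightarrow> nat) \<Rightarrow> bool" where
  "increasing_arith_prog L N \<longleftrightarrow>
     strict_mono_on {1..L} N \<and> (\<exists>d. \<forall>j\<in>{1..<L}. N (j + 1) = N j + d)"

end

theory Submission imports Defs begin

text \<open>
  The numbers are sought in the form \<open>N\<^sub>j = (m\<^sub>j n + 1) (n + 1) (c n + 1)\<close>, with fixed multipliers
  \<open>m\<^sub>j = K + j d\<close> in arithmetic progression, a fixed \<open>c\<close>, and an integer \<open>n > 0\<close> that the prime tuple
  conjecture has to provide. Two of the three factors do not depend on \<open>j\<close> and the third is linear
  in \<open>j\<close>, so \<open>N\<^sub>1, N\<^sub>2, \<dots>\<close> is an arithmetic progression for every \<open>n\<close>. Once the factors are prime,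
  Korselt's criterion (each prime factor minus one divides \<open>N\<^sub>j - 1\<close>) reduces to
  \<open>m\<^sub>j dvd c n + c + 1\<close> and \<open>c dvd m\<^sub>j n + m\<^sub>j + 1\<close>. These are congruence conditions on \<open>n\<close> modulo the
  \<open>m\<^sub>j\<close> and \<open>c\<close>; if every \<open>m\<^sub>j\<close> is \<open>-1\<close> modulo \<open>c\<close>, the second one holds for \<open>c dvd n\<close>. The conditions
  for different \<open>m\<^sub>j\<close> are all the single congruence \<open>c n = -(c + 1)\<close>, which is solvable modulo
  the product of the \<open>m\<^sub>j\<close> because that product is coprime to \<open>c\<close>.

  For the residue class, two factors are made congruent to \<open>a\<close> modulo \<open>q\<close> and the third one
  congruent to the inverse of \<open>a\<close>. This is achieved by \<open>n = a - 1\<close>, \<open>c = 1\<close> and \<open>a m\<^sub>j = -1\<close> modulo \<open>q\<close>,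
  since then \<open>a (m\<^sub>j n + 1) = -(a - 1) + a = 1\<close>. The choice \<open>c = q + 1\<close> satisfies this and is coprime
  to \<open>q\<close>. All three factors are then units modulo \<open>q\<close>.

  Putting \<open>n = n0 + Q t\<close>, where \<open>n0\<close> solves the congruences and \<open>Q = q c \<Prod>\<^sub>j m\<^sub>j\<close>, turns the \<open>L + 2\<close>
  factors into linear forms in \<open>t\<close>. A prime not dividing \<open>Q\<close> is never a fixed divisor, because some
  \<open>t\<close> makes \<open>n\<close> divisible by it and every form congruent to \<open>1\<close>. Hence admissibility only requires that the values
  at \<open>n0\<close> be coprime to \<open>Q\<close>. Modulo a divisor of \<open>m\<^sub>i\<close> this is automatic for \<open>n0 + 1\<close> and \<open>c n0 + 1\<close>,
  whereas for \<open>m\<^sub>l n0 + 1\<close> it says that \<open>m\<^sub>i\<close> is coprime to \<open>c - m\<^sub>l (c + 1)\<close>. This last requirement is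
  the delicate one. Eliminating \<open>d\<close> shows that a common divisor of the two numbers divides
  \<open>R = (c + 1) K (l - i) + i c\<close>, a number that does not involve \<open>d\<close>. If \<open>K\<close> is coprime to \<open>i\<close> and to \<open>c\<close>,
  then it is coprime to \<open>R\<close>, which is nonzero because \<open>K > 1\<close>. Choosing for \<open>d\<close> a multiple of all these \<open>R\<close>, a
  common divisor of \<open>m\<^sub>i = K + i d\<close> and \<open>R\<close> divides \<open>K\<close> as well, so it is a unit
  (\<open>multipliers_exist\<close>).

  The congruence \<open>a K = -1\<close> modulo \<open>q\<close> makes \<open>K\<close> coprime to all divisors of \<open>q\<close>. For these to include
  every \<open>i\<close> from \<open>1\<close> to \<open>L\<close>, the modulus \<open>q\<close> is enlarged to \<open>q L!\<close> at the outset, and \<open>a\<close> is replaced by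
  a representative of its class modulo \<open>q\<close> that is coprime to \<open>q L!\<close>
  (\<open>coprime_representative\<close>).
\<close>

section \<open>Coprime representatives of a residue class\<close>

text \<open>
  Only primes dividing \<open>F\<close> matter. Adding \<open>q\<close> times the product of those that do not divide \<open>a\<close>
  leaves these as nondivisors; a prime dividing both \<open>F\<close> and \<open>a\<close> divides neither \<open>q\<close> nor that product.
\<close>

lemma coprime_representative:
  fixes a q F :: nat
  assumes "coprime a q" "F > 0"
  obtains b where "[b = a] (mod q)" "coprime b F"
proof
  define t where "t = \<Prod>{p \<in> prime_factors F. \<not> p dvd a}"
  show "[a + q * t = a] (mod q)"
    by (simp add: cong_def)
  have t_iff: "p dvd t \<longleftrightarrow> \<not> p dvd a" if p: "prime p" "p dvd F" for p
  proof -
    have "p dvd t \<longleftrightarrow> (\<exists>r \<in> {r \<in> prime_factors F. \<not> r dvd a}. p dvd r)"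
      unfolding t_def by (rule prime_dvd_prod_iff[of _ p "\<lambda>r. r"]) (use p in auto)
    also have "\<dots> \<longleftrightarrow> \<not> p dvd a"
      using p \<open>F > 0\<close> by (auto simp: prime_factors_dvd dest: primes_dvd_imp_eq)
    finally show ?thesis .
  qed
  show "coprime (a + q * t) F"
  proof (rule ccontr)
    assume "\<not> coprime (a + q * t) F"
    hence "gcd (a + q * t) F \<noteq> 1" using coprime_iff_gcd_eq_1 by blast
    then obtain p where "prime p" "p dvd gcd (a + q * t) F" using prime_factor_nat by blast
    hence p: "prime p" "p dvd a + q * t" "p dvd F" by auto
    show False
    proof (cases "p dvd a")
      case True
      hence "p dvd q" using p t_iff[of p] by (simp add: dvd_add_right_iff prime_dvd_mult_iff)
      with True p(1) \<open>coprime a q\<close> show False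
        by (metis coprime_common_divisor not_prime_unit)
    next
      case False
      with t_iff[of p] p show False by (simp add: dvd_add_left_iff)
    qed
  qed
qed

section \<open>Korselt's criterion for three prime factors\<close>

text \<open>The prime-by-prime form of the Carmichael property, a consequence of Fermat's little theorem.\<close>
lemma prime_dvd_power_diff:
  fixes p :: nat and x :: int
  assumes "prime p" "N > 0" "p - 1 dvd N - 1"
  shows "int p dvd x ^ N - x"
proof -
  define y where "y = nat (x mod int p)"
  have p0: "p > 0" using assms(1) prime_gt_0_nat by blast
  have xy: "[x = int y] (mod int p)"
    using p0 by (simp add: y_def cong_def)
  obtain k where k: "N - 1 = (p - 1) * k" using assms(3) by blast
  have "[y ^ N = y] (mod p)"
  proof (cases "p dvd y")
    case True
    thus ?thesis using \<open>N > 0\<close> by (metis cong_def dvd_imp_mod_0 dvd_trans dvd_power)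
  next
    case False
    hence "[y ^ (p - 1) = 1] (mod p)" using assms(1) by (rule fermat_theorem[rotated])
    hence "[y ^ (N - 1) = 1] (mod p)"
      unfolding k power_mult by (metis cong_pow power_one)
    hence "[y * y ^ (N - 1) = y * 1] (mod p)" by (rule cong_scalar_left)
    thus ?thesis using \<open>N > 0\<close> by (simp add: power_eq_if)
  qed
  hence "[int y ^ N = int y] (mod int p)"
    by (metis cong_int_iff of_nat_power)
  with xy have "[x ^ N = x] (mod int p)"
    by (meson cong_pow cong_sym cong_trans)
  thus ?thesis by (simp add: cong_iff_dvd_diff)
qed

lemma carmichael_three_primes:
  fixes p r s :: nat
  assumes "prime p" "prime r" "prime s" "p \<noteq> r" "p \<noteq> s" "r \<noteq> s"
    and "p - 1 dvd p * r * s - 1" "r - 1 dvd p * r * s - 1" "s - 1 dvd p * r * s - 1"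
  shows "carmichael (p * r * s)"
  unfolding carmichael_def
proof (intro conjI allI)
  have gt: "p > 1" "r > 1" "s > 1" using assms prime_gt_1_nat by auto
  show "p * r * s > 1" using gt by (simp add: one_less_mult)
  show "\<not> prime (p * r * s)"
    using gt prime_product[of "p * r" s] by (auto simp: nat_mult_eq_1_iff)
  fix x :: int
  have "coprime p r" "coprime p s" "coprime r s"
    using assms primes_coprime by auto
  moreover have "int u dvd x ^ (p * r * s) - x" if "u \<in> {p, r, s}" for u
    using that assms gt by (intro prime_dvd_power_diff) auto
  ultimately have "int (p * r * s) dvd x ^ (p * r * s) - x"
    unfolding of_nat_mult by (intro divides_mult) auto
  thus "[x ^ (p * r * s) = x] (mod int (p * r * s))"
    by (simp add: cong_iff_dvd_diff)
qed

section \<open>The prime tuple conjecture for forms with a common shift\<close>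

lemma admissible_if_residues_avoided:
  assumes "\<And>p::nat. prime p \<Longrightarrow> \<exists>n. \<forall>j\<in>{1..k}. \<not> int p dvd g j * n + h j"
  shows "admissible k g h"
  unfolding admissible_def
proof (intro allI impI)
  fix p :: nat
  assume p: "prime p"
  define R where "R = {n \<in> {0..<int p}. [poly (tuple_poly k g h) n = 0] (mod int p)}"
  have p0: "p > 0" using p prime_gt_0_nat by blast
  obtain n where n: "\<forall>j\<in>{1..k}. \<not> int p dvd g j * n + h j"
    using assms[OF p] by blast
  have "\<not> int p dvd g j * (n mod int p) + h j" if "j \<in> {1..k}" for j
  proof -
    have "[g j * (n mod int p) + h j = g j * n + h j] (mod int p)"
      by (intro cong_add cong_mult cong_refl) (simp add: cong_def)
    thus ?thesis using n that cong_dvd_iff by blast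
  qed
  hence "\<not> int p dvd (\<Prod>j=1..k. g j * (n mod int p) + h j)"
    using p by (subst prime_dvd_prod_iff) auto
  hence "n mod int p \<notin> R"
    by (simp add: R_def tuple_poly_def poly_prod cong_0_iff add.commute mult.commute)
  moreover have "n mod int p \<in> {0..<int p}" using p0 by simp
  moreover have "R \<subseteq> {0..<int p}" by (auto simp: R_def)
  ultimately have "R \<subset> {0..<int p}" by blast
  hence "card R < card {0..<int p}" by (intro psubset_card_mono) auto
  thus "card R \<noteq> p" by simp
qed

text \<open>
  The conjecture in the shape used for primes one more than a multiple of \<open>n\<close>: a prime
  not dividing \<open>Q\<close> cannot obstruct, since \<open>n = n0 + Q t\<close> can be made divisible by it, and for a prime
  dividing \<open>Q\<close> the residues of the forms are those at \<open>n0\<close>.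
\<close>
lemma prime_tuple_progression:
  fixes b :: "nat \<Rightarrow> int" and n0 Q :: int
  assumes "prime_tuple_conjecture k"
    and pos: "\<And>j. j \<in> {1..k} \<Longrightarrow> b j > 0" and inj: "inj_on b {1..k}" and "Q > 0"
    and cop: "\<And>j. j \<in> {1..k} \<Longrightarrow> coprime (b j * n0 + 1) Q"
  obtains n where "n > 0" "[n = n0] (mod Q)" "\<And>j. j \<in> {1..k} \<Longrightarrow> prime (b j * n + 1)"
proof -
  define g h where "g = (\<lambda>j. b j * Q)" and "h = (\<lambda>j. b j * n0 + 1)"
  have "admissible k g h"
  proof (rule admissible_if_residues_avoided)
    fix p :: nat
    assume p: "prime p"
    hence pint: "prime (int p)" by simp
    show "\<exists>n. \<forall>j\<in>{1..k}. \<not> int p dvd g j * n + h j"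
    proof (cases "int p dvd Q")
      case True
      show ?thesis
      proof (intro exI[of _ 0] ballI)
        fix j assume "j \<in> {1..k}"
        from cop[OF this] True pint show "\<not> int p dvd g j * 0 + h j"
          by (auto simp: h_def dest: coprime_common_divisor)
      qed
    next
      case False
      hence "coprime Q (int p)"
        using pint prime_imp_coprime coprime_commute by blast
      then obtain u where "[Q * u = 1] (mod int p)" using cong_solve_coprime_int by blast
      hence u: "int p dvd Q * u - 1" by (simp add: cong_iff_dvd_diff)
      \<comment> \<open>At this point \<open>t\<close> the number \<open>n0 + Q t\<close> vanishes modulo \<open>p\<close>, so that every form is \<open>1\<close>.\<close>
      show ?thesis
      proof (intro exI[of _ "- n0 * u"] ballI notI)
        fix j assume "int p dvd g j * (- n0 * u) + h j"
        moreover have "g j * (- n0 * u) + h j = 1 - b j * n0 * (Q * u - 1)"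
          by (simp add: g_def h_def algebra_simps)
        ultimately have "int p dvd 1 - b j * n0 * (Q * u - 1)" by simp
        moreover have "int p dvd b j * n0 * (Q * u - 1)" using u by simp
        ultimately have "int p dvd 1" by (metis diff_add_cancel dvd_add)
        with pint show False using not_prime_unit by blast
      qed
    qed
  qed
  moreover have "\<forall>j\<in>{1..k}. g j > 0" using pos \<open>Q > 0\<close> by (simp add: g_def)
  moreover have "(\<Prod>j=1..k. \<Prod>i=1..<j. (g i * h j - g j * h i)) \<noteq> 0"
  proof -
    have "g i * h j - g j * h i \<noteq> 0" if "j \<in> {1..k}" "i \<in> {1..<j}" for i j
    proof -
      have "b i \<noteq> b j" using that inj by (auto dest: inj_onD)
      moreover have "g i * h j - g j * h i = Q * (b i - b j)"
        by (simp add: g_def h_def algebra_simps)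
      ultimately show ?thesis using \<open>Q > 0\<close> by simp
    qed
    thus ?thesis by simp
  qed
  ultimately have "infinite {n::nat. n > 0 \<and> (\<forall>j\<in>{1..k}. prime (g j * int n + h j))}"
    using assms(1) unfolding prime_tuple_conjecture_def by blast
  \<comment> \<open>\<open>n0\<close> may be negative, so \<open>t\<close> is taken large enough for \<open>n0 + Q t\<close> to be positive.\<close>
  then obtain t :: nat where t: "t > nat \<bar>n0\<bar>" "\<forall>j\<in>{1..k}. prime (g j * int t + h j)"
    unfolding infinite_nat_iff_unbounded by blast
  show thesis
  proof
    have "1 * int t \<le> Q * int t" using \<open>Q > 0\<close> by (intro mult_right_mono) auto
    thus "Q * int t + n0 > 0" using t(1) by linarith
    show "[Q * int t + n0 = n0] (mod Q)" by (simp add: cong_def)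
    fix j assume "j \<in> {1..k}"
    thus "prime (b j * (Q * int t + n0) + 1)"
      using t(2) by (simp add: g_def h_def algebra_simps)
  qed
qed

section \<open>Choice of the multipliers\<close>

text \<open>
  The coprimality at the end is what keeps a prime factor of \<open>K + i d\<close> from dividing the
  form with multiplier \<open>K + l d\<close>. A common divisor of the two numbers divides a number \<open>R\<close> that does
  not involve \<open>d\<close>; so \<open>K\<close> is fixed first, coprime to every \<open>R\<close>, and \<open>d\<close> is chosen afterwards, divisible
  by every \<open>R\<close>. The hypothesis on \<open>fact L\<close> makes \<open>K\<close>, a unit modulo \<open>q\<close>, coprime to
  \<open>1, \<dots>, L\<close>.
\<close>
lemma multipliers_exist:
  fixes a q :: int
  assumes "coprime a q" "q > 0" "fact L dvd q"
  obtains K d :: int where "K > q" "d > 0"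
    and "\<And>j. [a * (K + j * d) = -1] (mod q)" "\<And>j. [K + j * d = -1] (mod (q + 1))"
    and "\<And>i l. i \<in> {1..L} \<Longrightarrow> l \<in> {1..L} \<Longrightarrow>
           coprime (K + int i * d) (q + 1 - (K + int l * d) * (q + 2))"
proof -
  define c where "c = q + 1"
  obtain e0 where e0: "[a * e0 = 1] (mod q)" using cong_solve_coprime_int[OF assms(1)] by blast
  \<comment> \<open>The summand \<open>q\<close> makes \<open>e\<close> positive even for \<open>q = 1\<close>, which gives \<open>K > 1\<close>.\<close>
  define e where "e = (- e0) mod q + q"
  have "[e = - e0] (mod q)" by (simp add: e_def cong_def)
  hence "[a * e = a * (- e0)] (mod q)" by (rule cong_scalar_left)
  moreover have "[a * (- e0) = -1] (mod q)" using e0 by (simp add: cong_minus_minus_iff)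
  ultimately have ae: "[a * e = -1] (mod q)" by (rule cong_trans)
  have e1: "e \<ge> 1" using \<open>q > 0\<close> pos_mod_sign[of q "- e0"] unfolding e_def by linarith
  \<comment> \<open>As \<open>c = 1\<close> modulo \<open>q\<close>, this is an explicit solution of \<open>K = e\<close> modulo \<open>q\<close> and \<open>K = -1\<close> modulo \<open>c\<close>.\<close>
  define K where "K = (e + 1) * c - 1"
  have "2 * c \<le> (e + 1) * c" using e1 \<open>q > 0\<close> by (intro mult_right_mono) (auto simp: c_def)
  hence Kq: "K > q" "K > 1" using \<open>q > 0\<close> by (auto simp: K_def c_def)
  have Kc: "[K = -1] (mod c)" by (simp add: K_def cong_iff_dvd_diff)
  have Ke: "[K = e] (mod q)" 
    by (simp add: K_def c_def cong_iff_dvd_diff algebra_simps)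
  have aK: "[a * K = -1] (mod q)" using cong_scalar_left[OF Ke, of a] ae by (rule cong_trans)
  have Kcop: "coprime K i" if "i dvd q" for i
  proof (rule coprimeI)
    fix r assume r: "r dvd K" "r dvd i"
    hence "r dvd q" "r dvd a * K" using that dvd_trans by auto
    moreover have "q dvd a * K + 1" using aK by (simp add: cong_iff_dvd_diff)
    ultimately show "is_unit r" by (meson dvd_add_right_iff dvd_trans)
  qed
  have Kcopc: "coprime K c"
  proof (rule coprimeI)
    fix r assume r: "r dvd K" "r dvd c"
    moreover have "c dvd K + 1" using Kc by (simp add: cong_iff_dvd_diff)
    ultimately show "is_unit r" by (meson dvd_add_right_iff dvd_trans)
  qed
  \<comment> \<open>\<open>X\<close> bounds \<open>q\<close>, \<open>c\<close> and all \<open>\<bar>R\<bar>\<close> below, so its factorial is a common multiple of them.\<close>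
  define X where "X = nat (q + c + (1 + c) * K * int L + int L * c)"
  define d :: int where "d = fact X"
  have dvd_d: "r dvd d" if "r \<noteq> 0" "\<bar>r\<bar> \<le> int X" for r :: int
  proof -
    have "nat \<bar>r\<bar> dvd fact X" using that by (intro dvd_fact) auto
    hence "int (nat \<bar>r\<bar>) dvd int (fact X)" by (simp only: of_nat_dvd_iff)
    thus ?thesis by (simp add: d_def)
  qed
  have X: "int X = q + c + (1 + c) * K * int L + int L * c"
    using Kq \<open>q > 0\<close> by (simp add: X_def c_def)
  have nonneg: "(1 + c) * K * int L \<ge> 0" "int L * c \<ge> 0" using Kq \<open>q > 0\<close> by (auto simp: c_def)
  have qd: "q dvd d" and cd: "c dvd d"
    using nonneg \<open>q > 0\<close> by (auto intro!: dvd_d simp: X c_def)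
  have "coprime (K + int i * d) (c - (K + int l * d) * (1 + c))"
    if il: "i \<in> {1..L}" "l \<in> {1..L}" for i l
  proof -
    define R where "R = (1 + c) * K * (int l - int i) + int i * c"
    have "i dvd fact L" using il by (intro dvd_fact) auto
    hence "int i dvd int (fact L)" by (simp only: of_nat_dvd_iff)
    hence iq: "int i dvd q" using assms(3) dvd_trans by auto
    have KR: "coprime K R"
    proof -
      have "coprime K (int i * c)" using Kcop[OF iq] Kcopc by simp
      hence "coprime K (int i * c + K * ((1 + c) * (int l - int i)))"
        by (metis coprime_iff_gcd_eq_1 gcd_add_mult mult.commute add.commute)
      thus ?thesis by (simp add: R_def algebra_simps)
    qed
    \<comment> \<open>The only numbers coprime to \<open>0\<close> are units, and \<open>K > 1\<close>.\<close>
    hence "R \<noteq> 0" using Kq by auto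
    moreover have "\<bar>R\<bar> \<le> int X"
    proof -
      have "\<bar>(1 + c) * K * (int l - int i)\<bar> \<le> (1 + c) * K * int L"
        using il Kq \<open>q > 0\<close> unfolding abs_mult by (intro mult_mono) (auto simp: c_def)
      moreover have "\<bar>int i * c\<bar> \<le> int L * c"
        using il \<open>q > 0\<close> unfolding abs_mult by (intro mult_mono) (auto simp: c_def)
      moreover have "q + c > 0" using \<open>q > 0\<close> by (simp add: c_def)
      ultimately show ?thesis unfolding R_def X by linarith
    qed
    ultimately have Rd: "R dvd d" by (rule dvd_d)
    show ?thesis
    proof (rule coprimeI)
      fix r assume r: "r dvd K + int i * d" "r dvd c - (K + int l * d) * (1 + c)"
      \<comment> \<open>The combination of the two numbers in which \<open>d\<close> cancels.\<close>
      have "R = (1 + c) * int l * (K + int i * d) + int i * (c - (K + int l * d) * (1 + c))"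
        by (simp add: R_def algebra_simps)
      hence rR: "r dvd R" using r by simp
      hence "r dvd int i * d" using Rd by (meson dvd_mult dvd_trans)
      hence "r dvd K" using r(1) by (simp add: dvd_add_left_iff)
      with rR KR show "is_unit r" using coprime_common_divisor by blast
    qed
  qed
  moreover have "[a * (K + j * d) = -1] (mod q)" for j
  proof -
    have "a * (K + j * d) - (-1) = (a * K - (-1)) + (a * j) * d" by (simp add: algebra_simps)
    thus ?thesis using aK qd unfolding cong_iff_dvd_diff by (metis dvd_add dvd_mult)
  qed
  moreover have "[K + j * d = -1] (mod c)" for j
  proof -
    have "K + j * d - (-1) = (K - (-1)) + j * d" by (simp add: algebra_simps)
    thus ?thesis using Kc cd unfolding cong_iff_dvd_diff by (metis dvd_add dvd_mult)
  qed
  moreover have "d > 0" by (simp add: d_def)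
  ultimately show thesis
    using Kq(1) that[of K d] by (simp add: c_def add.commute)
qed

section \<open>The base point of the progression of shifts\<close>

text \<open>
  All congruence conditions on \<open>n\<close> are solved by the Chinese remainder theorem: the condition for
  \<open>m i\<close> has the same form for every \<open>i\<close>, so it is imposed once modulo \<open>\<Prod>m i\<close>, and the \<open>m i\<close> may share
  prime factors. What has to be seen is that no prime factor of the modulus \<open>Q\<close> divides one of
  the forms at \<open>n\<close>. Modulo \<open>q\<close> the forms are \<open>a\<close>, \<open>a\<close> and the inverse of \<open>a\<close>; modulo \<open>q + 1\<close> they are \<open>1\<close>;
  and modulo \<open>m i\<close> the congruence \<open>c n = -(c + 1)\<close>, with \<open>c = q + 1\<close>, turns them, after multiplying the
  first and the third by the unit \<open>c\<close>, into \<open>-1\<close>, \<open>-c\<close> and \<open>c - m l (c + 1)\<close>.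
\<close>
lemma base_point_exists:
  fixes a q :: int and m :: "nat \<Rightarrow> int"
  assumes "coprime a q" "q > 0" "finite I"
    and mpos: "\<And>i. i \<in> I \<Longrightarrow> m i > 0"
    and mq: "\<And>i. i \<in> I \<Longrightarrow> [a * m i = -1] (mod q)"
    and mc: "\<And>i. i \<in> I \<Longrightarrow> [m i = -1] (mod (q + 1))"
    and mm: "\<And>i l. i \<in> I \<Longrightarrow> l \<in> I \<Longrightarrow> coprime (m i) (q + 1 - m l * (q + 2))"
  obtains n Q where "Q > 0" "q dvd Q" "q + 1 dvd Q" "\<And>i. i \<in> I \<Longrightarrow> m i dvd Q"
    and "[n = a - 1] (mod q)" "q + 1 dvd n" "\<And>i. i \<in> I \<Longrightarrow> m i dvd (q + 1) * n + q + 2"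
    and "coprime (n + 1) Q" "coprime ((q + 1) * n + 1) Q"
    and "\<And>l. l \<in> I \<Longrightarrow> coprime (m l * n + 1) Q"
proof -
  define c where "c = q + 1"
  define M where "M = (\<Prod>i\<in>I. m i)"
  have qc: "coprime q c" by (simp add: c_def)
  have mq': "coprime (m i) q" if "i \<in> I" for i
  proof (rule coprimeI)
    fix r assume "r dvd m i" "r dvd q"
    moreover have "q dvd a * m i + 1" using mq[OF that] by (simp add: cong_iff_dvd_diff)
    ultimately show "is_unit r" by (meson dvd_add_right_iff dvd_trans dvd_mult)
  qed
  have mc': "coprime (m i) c" if "i \<in> I" for i
  proof (rule coprimeI)
    fix r assume "r dvd m i" "r dvd c"
    moreover have "c dvd m i + 1" using mc[OF that] by (simp add: c_def cong_iff_dvd_diff)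
    ultimately show "is_unit r" by (meson dvd_add_right_iff dvd_trans)
  qed
  have Mq: "coprime M q" and Mc: "coprime M c"
    unfolding M_def using mq' mc' by (auto intro: prod_coprime_left)
  obtain y where y: "[c * y = 1] (mod M)"
    using cong_solve_coprime_int[of c M] Mc by (auto simp: coprime_commute)
  obtain x where x: "[x = a - 1] (mod q)" "[x = 0] (mod c)"
    using binary_chinese_remainder_int[OF qc] by blast
  have "coprime (q * c) M" using Mq Mc by (simp add: coprime_commute)
  then obtain n where n: "[n = x] (mod q * c)" "[n = - (c + 1) * y] (mod M)"
    using binary_chinese_remainder_int by blast
  have nq: "[n = a - 1] (mod q)"
    using n(1) x(1) by (meson cong_modulus_mult cong_trans)
  have "[n = 0] (mod c)"
    using n(1) x(2) by (metis cong_modulus_mult cong_trans mult.commute)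
  hence nc: "c dvd n" by (simp add: cong_0_iff)
  have "[c * n = c * (- (c + 1) * y)] (mod M)" using n(2) by (rule cong_scalar_left)
  also have "c * (- (c + 1) * y) = - (c + 1) * (c * y)" by (simp add: algebra_simps)
  also have "[- (c + 1) * (c * y) = - (c + 1) * 1] (mod M)" using y by (rule cong_scalar_left)
  finally have "M dvd c * n + (c + 1)" by (simp add: cong_iff_dvd_diff algebra_simps)
  moreover have mM: "m i dvd M" if "i \<in> I" for i
    unfolding M_def using \<open>finite I\<close> that by (rule dvd_prodI)
  ultimately have nm: "m i dvd c * n + (c + 1)" if "i \<in> I" for i
    using that dvd_trans by blast
  define Q where "Q = q * c * M"
  have cop_Q: "coprime u Q" if "coprime u q" "coprime u c" "\<And>i. i \<in> I \<Longrightarrow> coprime u (m i)" for u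
    unfolding Q_def M_def using that by (auto intro: prod_coprime_right)
  have cop_c: "coprime (u * n + 1) c" for u
  proof (rule coprimeI)
    fix r assume "r dvd u * n + 1" "r dvd c"
    thus "is_unit r" using nc by (meson dvd_add_right_iff dvd_trans dvd_mult)
  qed
  have unit: "coprime u r" if "r dvd u * v + w" "is_unit w" for u v w r :: int
  proof (rule coprimeI)
    fix s assume "s dvd u" "s dvd r"
    hence "s dvd w" using that(1) by (meson dvd_add_right_iff dvd_trans dvd_mult2)
    thus "is_unit s" using that(2) dvd_trans by blast
  qed
  have aq: "coprime u q" if "[u = a] (mod q)" for u
    using that assms(1) by (metis cong_imp_coprime cong_sym)
  have na: "[n + 1 = a] (mod q)" using cong_add[OF nq cong_refl[of 1]] by simp
  show thesis
  proof (rule that[of Q n])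
    have "M > 0" unfolding M_def using mpos by (intro prod_pos) auto
    thus "Q > 0" using \<open>q > 0\<close> by (simp add: Q_def c_def)
    show "q dvd Q" "q + 1 dvd Q" by (simp_all add: Q_def c_def)
    show "m i dvd Q" if "i \<in> I" for i using mM[OF that] by (simp add: Q_def)
    show "[n = a - 1] (mod q)" by (fact nq)
    show "q + 1 dvd n" using nc by (simp add: c_def)
    show "m i dvd (q + 1) * n + q + 2" if "i \<in> I" for i
      using nm[OF that] by (simp add: c_def algebra_simps)
    show "coprime (n + 1) Q"
    proof (rule cop_Q)
      show "coprime (n + 1) q" using na by (rule aq)
      show "coprime (n + 1) c" using cop_c[of 1] by simp
      show "coprime (n + 1) (m i)" if "i \<in> I" for i
        using nm[OF that] by (intro unit[of _ _ c 1]) (auto simp: algebra_simps)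
    qed
    show "coprime ((q + 1) * n + 1) Q"
    proof (rule cop_Q)
      have "[(q + 1) * n + 1 = 1 * n + 1] (mod q)"
        by (intro cong_add cong_mult) (auto simp: cong_def)
      thus "coprime ((q + 1) * n + 1) q" using na by (intro aq) (simp add: cong_trans)
      show "coprime ((q + 1) * n + 1) c" by (rule cop_c)
      fix i assume i: "i \<in> I"
      have "coprime (m i) ((q + 1) * n + 1)"
      proof (rule coprimeI)
        fix s assume s: "s dvd m i" "s dvd (q + 1) * n + 1"
        have "s dvd c * n + (c + 1)" using s(1) nm[OF i] by (rule dvd_trans)
        also have "c * n + (c + 1) = ((q + 1) * n + 1) + c" by (simp add: c_def)
        finally have "s dvd c" using s(2) by (simp add: dvd_add_right_iff)
        thus "is_unit s" using mc'[OF i] s(1) coprime_common_divisor by blast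
      qed
      thus "coprime ((q + 1) * n + 1) (m i)" by (simp add: coprime_commute)
    qed
    show "coprime (m l * n + 1) Q" if l: "l \<in> I" for l
    proof (rule cop_Q)
      have "[a * m l * n + a = -1 * (a - 1) + a] (mod q)"
        using mq[OF l] nq by (intro cong_add cong_mult cong_refl)
      hence "q dvd (m l * n + 1) * a + -1"
        by (simp add: cong_iff_dvd_diff algebra_simps)
      thus "coprime (m l * n + 1) q" by (rule unit) simp
      show "coprime (m l * n + 1) c" by (rule cop_c)
      fix i assume i: "i \<in> I"
      have "coprime (m i) (m l * n + 1)"
      proof (rule coprimeI)
        fix s assume s: "s dvd m i" "s dvd m l * n + 1"
        have "q + 1 - m l * (q + 2) = c * (m l * n + 1) - m l * (c * n + (c + 1))"
          by (simp add: c_def algebra_simps)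
        moreover have "s dvd c * n + (c + 1)" using s(1) nm[OF i] by (rule dvd_trans)
        ultimately have "s dvd q + 1 - m l * (q + 2)" using s(2) by simp
        thus "is_unit s" using mm[OF i l] s(1) coprime_common_divisor by blast
      qed
      thus "coprime (m l * n + 1) (m i)" by (simp add: coprime_commute)
    qed
  qed
qed

section \<open>Carmichael numbers from the multipliers\<close>

text \<open>
  Korselt's criterion and the residue class for a single term. The
  product of the other two primes, minus one, is \<open>n ((q + 1) n + q + 2)\<close> for \<open>A\<close> and
  \<open>n (m n + m + 1)\<close> for \<open>C\<close>, so that the congruences on \<open>n\<close> give divisibility by \<open>m n\<close> and \<open>(q + 1) n\<close>.
  Modulo \<open>q\<close> the factors \<open>B\<close> and \<open>C\<close> are \<open>a\<close> and \<open>A\<close> is inverse to \<open>a\<close>.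
\<close>
lemma carmichael_from_multipliers:
  fixes a q n m :: int and A B C :: nat
  assumes pos: "n > 0" "q > 0" "m > q + 1"
    and ABC: "int A = m * n + 1" "int B = n + 1" "int C = (q + 1) * n + 1"
    and primes: "prime A" "prime B" "prime C"
    and m: "[a * m = -1] (mod q)" "[m = -1] (mod (q + 1))"
    and n: "[n = a - 1] (mod q)" "q + 1 dvd n" "m dvd (q + 1) * n + q + 2"
  shows "carmichael (A * B * C)" "[int (A * B * C) = a] (mod q)"
    "product_of_three_distinct_primes (A * B * C)"
proof -
  have "n < (q + 1) * n" "(q + 1) * n < m * n" using pos by auto
  hence "int A \<noteq> int B" "int A \<noteq> int C" "int B \<noteq> int C" unfolding ABC by auto
  hence neq: "A \<noteq> B" "A \<noteq> C" "B \<noteq> C" by auto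
  show "product_of_three_distinct_primes (A * B * C)"
    unfolding product_of_three_distinct_primes_def using primes neq by blast
  have ge1: "A \<ge> 1" "B \<ge> 1" "C \<ge> 1"
    using primes prime_ge_1_nat by auto
  hence ge: "A * B * C \<ge> 1" by simp
  have transfer: "U - 1 dvd A * B * C - 1" if "U \<ge> 1" "int U - 1 dvd int A * int B * int C - 1" for U
  proof -
    have "int (U - 1) dvd int (A * B * C - 1)" using that ge by (simp add: of_nat_diff)
    thus ?thesis by (simp only: of_nat_dvd_iff)
  qed
  show "carmichael (A * B * C)"
  proof (rule carmichael_three_primes[OF primes neq]; rule transfer)
    show "A \<ge> 1" "B \<ge> 1" "C \<ge> 1" by (fact ge1)+
    have "int A * int B * int C - 1 = m * n * (int B * int C) + n * ((q + 1) * n + q + 2)"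
      unfolding ABC by (simp add: algebra_simps)
    moreover have "m * n dvd n * ((q + 1) * n + q + 2)"
      using n(3) by (subst mult.commute) (rule mult_dvd_mono, auto)
    ultimately show "int A - 1 dvd int A * int B * int C - 1"
      unfolding ABC(1) by (metis add_diff_cancel_right' dvd_add dvd_triv_left)
    have "int A * int B * int C - 1 = n * (int A * int C + m * int C + q + 1)"
      unfolding ABC by (simp add: algebra_simps)
    thus "int B - 1 dvd int A * int B * int C - 1"
      unfolding ABC(2) by simp
    have "int A * int B * int C - 1 = (q + 1) * n * (int A * int B) + n * (m * n + (m + 1))"
      unfolding ABC by (simp add: algebra_simps)
    moreover have "q + 1 dvd m * n + (m + 1)"
      using m(2) n(2) by (simp add: cong_iff_dvd_diff)
    hence "(q + 1) * n dvd n * (m * n + (m + 1))"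
      by (subst mult.commute) (rule mult_dvd_mono, auto)
    ultimately show "int C - 1 dvd int A * int B * int C - 1"
      unfolding ABC(3) by (metis add_diff_cancel_right' dvd_add dvd_triv_left)
  qed
  have na: "[n + 1 = a] (mod q)" using cong_add[OF n(1) cong_refl[of 1]] by simp
  have "[(q + 1) * n + 1 = 1 * n + 1] (mod q)"
    by (intro cong_add cong_mult) (auto simp: cong_def)
  hence C: "[int C = a] (mod q)" using na unfolding ABC by (simp add: cong_trans)
  have B: "[int B = a] (mod q)" using na unfolding ABC .
  have "[int A * int B * int C = (m * (a - 1) + 1) * a * a] (mod q)"
    using B C n(1) unfolding ABC(1) by (intro cong_mult cong_add cong_refl)
  also have "(m * (a - 1) + 1) * a * a = (a * m + 1 - 1) * a * (a - 1) + a * a"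
    by (simp add: algebra_simps)
  also have "[\<dots> = (-1 + 1 - 1) * a * (a - 1) + a * a] (mod q)"
    using m(1) by (intro cong_mult cong_add cong_diff cong_refl)
  also have "(-1 + 1 - 1) * a * (a - 1) + a * a = a" by (simp add: algebra_simps)
  finally show "[int (A * B * C) = a] (mod q)" by simp
qed

section \<open>Arithmetic progressions of Carmichael numbers\<close>

theorem theorem1p1:
  fixes a q :: nat
  assumes "\<And>k. k \<ge> 1 \<Longrightarrow> prime_tuple_conjecture k"
    and "a > 0" and "q > 0" and "coprime a q"
  shows "\<forall>L\<ge>1. \<exists>N :: nat \<Rightarrow> nat.
           increasing_arith_prog L N \<and>
           (\<forall>j\<in>{1..L}. carmichael (N j) \<and> [N j = a] (mod q) \<and>
              product_of_three_distinct_primes (N j))"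
proof (intro allI impI)
  fix L :: nat
  assume "L \<ge> 1"
  obtain a' where a': "[a' = a] (mod q)" "coprime a' (q * fact L)"
    using coprime_representative[of a q "q * fact L"] assms by auto
  define \<alpha> \<rho> where "\<alpha> = int a'" and "\<rho> = int (q * fact L)"
  have cop: "coprime \<alpha> \<rho>" and pos: "\<rho> > 0" and "fact L dvd \<rho>"
    unfolding \<alpha>_def \<rho>_def using a' assms by (auto simp del: of_nat_mult) simp
  obtain K d :: int where K: "K > \<rho>" and d: "d > 0"
    and mq: "\<And>j. [\<alpha> * (K + j * d) = -1] (mod \<rho>)"
    and mc: "\<And>j. [K + j * d = -1] (mod (\<rho> + 1))"
    and mm: "\<And>i l. i \<in> {1..L} \<Longrightarrow> l \<in> {1..L} \<Longrightarrow>
           coprime (K + int i * d) (\<rho> + 1 - (K + int l * d) * (\<rho> + 2))"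
    using multipliers_exist[OF cop pos \<open>fact L dvd \<rho>\<close>] by blast
  define m where "m = (\<lambda>i. K + int i * d)"
  have m_gt: "m i > \<rho> + 1" if "i \<in> {1..L}" for i
  proof -
    have "1 * d \<le> int i * d" using d that by (intro mult_right_mono) auto
    thus ?thesis using K d unfolding m_def by linarith
  qed
  have m_pos: "m i > 0" if "i \<in> {1..L}" for i using m_gt[OF that] pos by simp
  obtain n0 Q where Q: "Q > 0" "\<rho> dvd Q" "\<rho> + 1 dvd Q" "\<And>i. i \<in> {1..L} \<Longrightarrow> m i dvd Q"
    and n0: "[n0 = \<alpha> - 1] (mod \<rho>)" "\<rho> + 1 dvd n0"
      "\<And>i. i \<in> {1..L} \<Longrightarrow> m i dvd (\<rho> + 1) * n0 + \<rho> + 2"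
    and cops: "coprime (n0 + 1) Q" "coprime ((\<rho> + 1) * n0 + 1) Q"
      "\<And>l. l \<in> {1..L} \<Longrightarrow> coprime (m l * n0 + 1) Q"
    using base_point_exists[OF cop pos, of "{1..L}" m] m_pos mq mc mm
    unfolding m_def by (smt (verit) finite_atLeastAtMost)
  \<comment> \<open>One tuple carries all primes: the \<open>L\<close> varying ones, then \<open>n + 1\<close> and \<open>(\<rho> + 1) n + 1\<close>.\<close>
  define b where "b = (\<lambda>j. if j \<le> L then m j else if j = L + 1 then 1 else \<rho> + 1)"
  obtain n where n: "n > 0" "[n = n0] (mod Q)" and
    primes: "\<And>j. j \<in> {1..L + 2} \<Longrightarrow> prime (b j * n + 1)"
  proof (rule prime_tuple_progression[of "L + 2" b Q n0])
    show "prime_tuple_conjecture (L + 2)" using assms(1) by simp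
    show "b j > 0" if "j \<in> {1..L + 2}" for j
      using that m_pos[of j] pos by (auto simp: b_def)
    show "inj_on b {1..L + 2}"
    proof (rule inj_onI)
      fix i j assume "i \<in> {1..L + 2}" "j \<in> {1..L + 2}" "b i = b j"
      thus "i = j" using m_gt[of i] m_gt[of j] pos d
        by (auto simp: b_def m_def split: if_splits)
    qed
    show "Q > 0" by (fact Q)
    show "coprime (b j * n0 + 1) Q" if "j \<in> {1..L + 2}" for j
      using that cops by (auto simp: b_def)
    fix n assume "n > 0" "[n = n0] (mod Q)" "\<And>j. j \<in> {1..L + 2} \<Longrightarrow> prime (b j * n + 1)"
    thus thesis by (rule that)
  qed
  define A where "A = (\<lambda>j. nat (m j * n + 1))"
  define B where "B = nat (n + 1)"
  define C where "C = nat ((\<rho> + 1) * n + 1)"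
  have intA: "int (A j) = m j * n + 1" if "j \<in> {1..L}" for j
    using m_pos[OF that] n(1) by (simp add: A_def)
  have intB: "int B = n + 1" and intC: "int C = (\<rho> + 1) * n + 1"
    using n(1) pos by (simp_all add: B_def C_def)
  have primeA: "prime (A j)" if j: "j \<in> {1..L}" for j
  proof -
    have "prime (b j * n + 1)" using j by (intro primes) auto
    moreover have "b j * n + 1 = int (A j)" using j by (simp add: b_def intA)
    ultimately show ?thesis by simp
  qed
  have primeB: "prime B"
  proof -
    have "prime (b (L + 1) * n + 1)" by (intro primes) auto
    moreover have "b (L + 1) * n + 1 = int B" by (simp add: b_def intB)
    ultimately show ?thesis by simp
  qed
  have primeC: "prime C"
  proof -
    have "prime (b (L + 2) * n + 1)" by (intro primes) auto
    moreover have "b (L + 2) * n + 1 = int C" by (simp add: b_def intC)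
    ultimately show ?thesis by simp
  qed
  have n_mod: "[n = n0] (mod r)" if "r dvd Q" for r
    using n(2) that by (rule cong_dvd_modulus)
  have n1: "[n = \<alpha> - 1] (mod \<rho>)" using n_mod[OF Q(2)] n0(1) by (rule cong_trans)
  have n2: "\<rho> + 1 dvd n" using n_mod[OF Q(3)] n0(2) cong_dvd_iff by blast
  have n3: "m j dvd (\<rho> + 1) * n + \<rho> + 2" if "j \<in> {1..L}" for j
  proof -
    have "[(\<rho> + 1) * n + \<rho> + 2 = (\<rho> + 1) * n0 + \<rho> + 2] (mod m j)"
      using n_mod[OF Q(4)[OF that]] by (intro cong_add cong_mult cong_refl)
    thus ?thesis using n0(3)[OF that] by (simp add: cong_dvd_iff)
  qed
  define N where "N = (\<lambda>j. A j * B * C)"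
  have step: "N (j + 1) = N j + nat (d * n) * B * C" if "j \<in> {1..<L}" for j
  proof -
    have "int (A (j + 1)) = int (A j) + d * n"
      using that by (subst (1 2) intA) (auto simp: m_def algebra_simps)
    hence "A (j + 1) = A j + nat (d * n)" using d n(1) by (simp add: nat_eq_iff2 flip: of_nat_eq_iff[where 'a = int])
    thus ?thesis by (simp add: N_def algebra_simps)
  qed
  have "strict_mono_on {1..L} N"
  proof (rule strict_mono_onI)
    fix i j assume ij: "i \<in> {1..L}" "j \<in> {1..L}" "i < j"
    have "m i * n < m j * n" using ij d n(1) by (simp add: m_def)
    hence "A i < A j" using intA[OF ij(1)] intA[OF ij(2)] by linarith
    moreover have "B * C > 0" using primeB primeC prime_gt_0_nat by simp
    ultimately show "N i < N j" by (simp add: N_def mult.assoc)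
  qed
  hence "increasing_arith_prog L N"
    unfolding increasing_arith_prog_def using step by blast
  moreover have "carmichael (N j) \<and> [N j = a] (mod q) \<and> product_of_three_distinct_primes (N j)"
    if j: "j \<in> {1..L}" for j
  proof -
    have mj: "[\<alpha> * m j = -1] (mod \<rho>)" "[m j = -1] (mod (\<rho> + 1))"
      unfolding m_def by (rule mq mc)+
    note * = carmichael_from_multipliers[OF n(1) pos m_gt[OF j] intA[OF j] intB intC
        primeA[OF j] primeB primeC mj n1 n2 n3[OF j]]
    have "[A j * B * C = a'] (mod q * fact L)"
      using *(2) unfolding \<alpha>_def \<rho>_def cong_int_iff .
    hence "[A j * B * C = a'] (mod q)" by (rule cong_modulus_mult_nat)
    with a'(1) have "[A j * B * C = a] (mod q)" by (rule cong_trans[rotated])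
    with *(1,3) show ?thesis by (simp add: N_def)
  qed
  ultimately show "\<exists>N. increasing_arith_prog L N \<and>
           (\<forall>j\<in>{1..L}. carmichael (N j) \<and> [N j = a] (mod q) \<and>
              product_of_three_distinct_primes (N j))"
    by blast
qed

end
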